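(* Consider a symmetric thrust-propelled vehicle, whose translational dynamics are $$m\vec a = m\vec g + \vec F_a - T\vec k .$$ Assume that the aerodynamic force is $\vec F_a=\vec F_L+\vec F_D$ with $$\vec F_L = k_a|\vec v_a|\,C_L(\alpha)\,\vec r(\beta)\times \vec v_a,\qquad \vec F_D=-k_a|\vec v_a|\,C_D(\alpha)\,\vec v_a,\qquad \vec r(\beta)=-\sin(\beta)\,\vec\imath+\cos(\beta)\,\vec\jmath ,$$ and that the aerodynamic coefficients satisfy the relationship $$C_D(\alpha)+C_L(\alpha)\cot(\alpha)=C_{D_0},$$ with $C_{D_0}$ denoting a constant number. Then the dynamic equation $m\vec a = m\vec g + \vec F_a - T\vec k$ may also be written as $$m\vec a=m\vec g+\vec F_p-T_p\vec k,$$ with $$T_p=T+k_a|\vec v_a|^2\,\frac{C_L(\alpha)}{\sin(\alpha)},\qquad \vec F_p=-k_a\,C_{D_0}\,|\vec v_a|\,\vec v_a .$$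
   Context: $(\vec\imath,\vec\jmath,\vec k)$ is a right-handed orthonormal basis of Euclidean 3-space attached to the vehicle's body, with body-frame origin $G$. The vehicle is symmetric in the sense that its external surface is invariant under every rotation about the axis through $G$ directed by $\vec k$. $m$ is the (constant) mass, $\vec a$ the linear acceleration of the center of mass, $\vec g$ the gravity acceleration vector, and $-T\vec k$ the thrust force, with $T$ the thrust intensity. The air velocity $\vec v_a=v_{a_1}\vec\imath+v_{a_2}\vec\jmath+v_{a_3}\vec k$ is the vehicle's velocity minus the wind velocity. $k_a=\rho\Sigma/2$, with $\rho$ the free stream air density and $\Sigma$ a reference area of the body. The angle of attack $\alpha\in[0,\pi]$ is the angle between $-\vec k$ and $\vec v_a$, and $\beta\in(-\pi,\pi]$ is the angle between $\vec\imath$ and the projection of $\vec v_a$ on the plane spanned by $\vec\imath,\vec\jmath$: $\alpha=\cos^{-1}(-v_{a_3}/|\vec v_a|)$, $\beta=\mathrm{atan2}(v_{a_2},v_{a_1})$, so that $v_{a_1}=|\vec v_a|\sin\alpha\cos\beta$, $v_{a_2}=|\vec v_a|\sin\alpha\sin\beta$, $v_{a_3}=-|\vec v_a|\cos\alpha$. $C_D$ and $C_L$ are the drag and lift coefficients; the Reynolds and Mach numbers are constant, so that these coefficients depend only on $\alpha$. By the symmetry of the body, the lift coefficient is zero when $\alpha\in\{0,\pi\}$. *)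

theory Defs
  imports "HOL-Analysis.Analysis"
begin

definition right_handed_orthonormal :: "real^3 \<Rightarrow> real^3 \<Rightarrow> real^3 \<Rightarrow> bool" where
  "right_handed_orthonormal i j k \<longleftrightarrow>
     norm i = 1 \<and> norm j = 1 \<and> norm k = 1 \<and>
     i \<bullet> j = 0 \<and> j \<bullet> k = 0 \<and> k \<bullet> i = 0 \<and> cross3 i j = k"

text \<open>The rotations about the axis through \<open>G\<close> directed by \<open>k\<close> are the maps
  \<open>x \<mapsto> G + R (x - G)\<close> with \<open>R\<close> a rotation matrix fixing \<open>k\<close>.\<close>

definition axisymmetric :: "(real^3) set \<Rightarrow> real^3 \<Rightarrow> real^3 \<Rightarrow> bool" where
  "axisymmetric S G k \<longleftrightarrow>
     (\<forall>R :: real^3^3. rotation_matrix R \<and> R *v k = k \<longrightarrow> (\<lambda>x. G + R *v (x - G)) ` S = S)"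

definition angle_of_attack :: "real^3 \<Rightarrow> real^3 \<Rightarrow> real" where
  "angle_of_attack k v\<^sub>a = arccos (- (v\<^sub>a \<bullet> k) / norm v\<^sub>a)"

text \<open>\<^const>\<open>Arg\<close> takes its values in \<open>(-\<pi>, \<pi>]\<close>, so \<open>Arg (Complex x y)\<close> is \<open>atan2 y x\<close>.\<close>

definition sideslip_angle :: "real^3 \<Rightarrow> real^3 \<Rightarrow> real^3 \<Rightarrow> real" where
  "sideslip_angle i j v\<^sub>a = Arg (Complex (v\<^sub>a \<bullet> i) (v\<^sub>a \<bullet> j))"

definition lift_axis :: "real^3 \<Rightarrow> real^3 \<Rightarrow> real \<Rightarrow> real^3" where
  "lift_axis i j \<beta> = - sin \<beta> *\<^sub>R i + cos \<beta> *\<^sub>R j"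

definition lift_force ::
  "real^3 \<Rightarrow> real^3 \<Rightarrow> real \<Rightarrow> (real \<Rightarrow> real) \<Rightarrow> real \<Rightarrow> real \<Rightarrow> real^3 \<Rightarrow> real^3" where
  "lift_force i j k\<^sub>a C\<^sub>L \<alpha> \<beta> v\<^sub>a =
     (k\<^sub>a * norm v\<^sub>a * C\<^sub>L \<alpha>) *\<^sub>R cross3 (lift_axis i j \<beta>) v\<^sub>a"

definition drag_force :: "real \<Rightarrow> (real \<Rightarrow> real) \<Rightarrow> real \<Rightarrow> real^3 \<Rightarrow> real^3" where
  "drag_force k\<^sub>a C\<^sub>D \<alpha> v\<^sub>a = - ((k\<^sub>a * norm v\<^sub>a * C\<^sub>D \<alpha>) *\<^sub>R v\<^sub>a)"

text \<open>The quotient \<open>C\<^sub>L(\<alpha>) / sin \<alpha>\<close> on \<open>[0, \<pi>]\<close>. At \<open>0\<close> and \<open>\<pi>\<close> numerator and denominator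
  both vanish and the quotient means its limit from inside the interval; the HOL convention
  \<open>x / 0 = 0\<close> would give a wrong value there.\<close>

definition lift_over_sin :: "(real \<Rightarrow> real) \<Rightarrow> real \<Rightarrow> real" where
  "lift_over_sin C\<^sub>L \<alpha> =
     (if 0 < \<alpha> \<and> \<alpha> < pi then C\<^sub>L \<alpha> / sin \<alpha>
      else Lim (at \<alpha> within {0<..<pi}) (\<lambda>x. C\<^sub>L x / sin x))"

text \<open>The relation \<open>C\<^sub>D(\<alpha>) + C\<^sub>L(\<alpha>) cot \<alpha> = C\<^sub>D\<^sub>0\<close> at one angle \<open>\<alpha>\<close> of \<open>[0, \<pi>]\<close>, with the
  indeterminate product \<open>C\<^sub>L(\<alpha>) cot \<alpha>\<close> at \<open>0\<close> and \<open>\<pi>\<close> again read as a limit.\<close>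

definition drag_lift_relation ::
  "(real \<Rightarrow> real) \<Rightarrow> (real \<Rightarrow> real) \<Rightarrow> real \<Rightarrow> real \<Rightarrow> bool" where
  "drag_lift_relation C\<^sub>D C\<^sub>L C\<^sub>D\<^sub>0 \<alpha> \<longleftrightarrow>
     (if 0 < \<alpha> \<and> \<alpha> < pi then C\<^sub>D \<alpha> + C\<^sub>L \<alpha> * cot \<alpha> = C\<^sub>D\<^sub>0
      else ((\<lambda>x. C\<^sub>D \<alpha> + C\<^sub>L x * cot x) \<longlongrightarrow> C\<^sub>D\<^sub>0) (at \<alpha> within {0<..<pi}))"

end

theory Submission
  imports Defs
begin

text \<open>In the body frame \<open>r(\<beta>) \<times> v\<^sub>a = - |v\<^sub>a| (cos \<alpha> h + sin \<alpha> k)\<close> with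
  \<open>h = cos \<beta> i + sin \<beta> j\<close>, while \<open>v\<^sub>a = |v\<^sub>a| (sin \<alpha> h - cos \<alpha> k)\<close>. Eliminating \<open>h\<close> for
  \<open>sin \<alpha> \<noteq> 0\<close> splits the lift into a part along \<open>v\<^sub>a\<close> with coefficient \<open>- C\<^sub>L cot \<alpha>\<close>, which
  together with the drag gives \<open>F\<^sub>p\<close>, and a part along \<open>k\<close>, which is absorbed by \<open>T\<^sub>p\<close>. For
  \<open>sin \<alpha> = 0\<close> the lift vanishes and \<open>v\<^sub>a\<close> is parallel to \<open>k\<close>, so only the limit of
  \<open>C\<^sub>L / sin\<close> is needed, which is read off from that of \<open>C\<^sub>L cot\<close>.\<close>

text \<open>The frame definition supplies only \<open>cross3 i j = k\<close>; writing
  \<open>k\<close> as this product and expanding the triple products by \<open>Lagrange\<close>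
  gives the other two.\<close>

lemma right_handed_orthonormal_cross:
  assumes "right_handed_orthonormal i j k"
  shows "cross3 i j = k" "cross3 j k = i" "cross3 k i = j"
proof -
  have *: "cross3 i j = k" "i \<bullet> i = 1" "j \<bullet> j = 1" "i \<bullet> j = 0" "j \<bullet> i = 0"
    using assms by (auto simp: right_handed_orthonormal_def norm_eq_1 inner_commute)
  show "cross3 i j = k" by fact
  show "cross3 j k = i"
    using * Lagrange[of j i j] by simp
  have "cross3 i k = - j"
    using * Lagrange[of i i j] by simp
  then show "cross3 k i = j"
    by (metis cross_skew minus_minus)
qed

lemma right_handed_orthonormal_expansion:
  assumes "right_handed_orthonormal i j k"
  shows "v = (v \<bullet> i) *\<^sub>R i + (v \<bullet> j) *\<^sub>R j + (v \<bullet> k) *\<^sub>R k"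
proof -
  define x where "x = v - ((v \<bullet> i) *\<^sub>R i + (v \<bullet> j) *\<^sub>R j + (v \<bullet> k) *\<^sub>R k)"
  have *: "i \<bullet> i = 1" "j \<bullet> j = 1" "k \<bullet> k = 1" "norm k = 1" "i \<bullet> j = 0" "j \<bullet> i = 0"
    "j \<bullet> k = 0" "k \<bullet> j = 0" "k \<bullet> i = 0" "i \<bullet> k = 0"
    using assms by (auto simp: right_handed_orthonormal_def norm_eq_1 inner_commute)
  have orth: "x \<bullet> i = 0" "x \<bullet> j = 0" "x \<bullet> k = 0"
    by (simp_all add: x_def inner_diff_left inner_add_left *)
  \<comment> \<open>Again \<open>k = cross3 i j\<close> is expanded by \<open>Lagrange\<close>. The
    remainder \<open>x\<close> is then both orthogonal and parallel to the unit vector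
    \<open>k\<close>, hence zero.\<close>
  have "cross3 x k = 0"
    using Lagrange[of x i j] orth right_handed_orthonormal_cross(1)[OF assms] by simp
  then have "x = 0"
    using norm_and_cross_eq_0[of x k] orth * by auto
  then show ?thesis by (simp add: x_def)
qed

lemma norm_frame_components:
  assumes "right_handed_orthonormal i j k"
  shows "(norm v)\<^sup>2 = (v \<bullet> i)\<^sup>2 + (v \<bullet> j)\<^sup>2 + (v \<bullet> k)\<^sup>2"
proof -
  have "v \<bullet> v = v \<bullet> ((v \<bullet> i) *\<^sub>R i + (v \<bullet> j) *\<^sub>R j + (v \<bullet> k) *\<^sub>R k)"
    using right_handed_orthonormal_expansion[OF assms, of v] by simp
  then show ?thesis
    unfolding power2_norm_eq_inner by (simp add: inner_add_right power2_eq_square)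
qed

text \<open>The projection of \<open>v\<close> on the plane of \<open>i\<close> and
  \<open>j\<close>, read as a complex number, has argument \<beta> and, by Pythagoras, modulus
  \<open>norm v * sin \<alpha>\<close>. If the modulus is zero, both components vanish whatever
  \<beta> is.\<close>

lemma air_velocity_spherical:
  assumes fr: "right_handed_orthonormal i j k"
    and nz: "v \<noteq> 0"
    and \<alpha>: "\<alpha> = angle_of_attack k v"
    and \<beta>: "\<beta> = sideslip_angle i j v"
  shows "v \<bullet> i = norm v * sin \<alpha> * cos \<beta>" "v \<bullet> j = norm v * sin \<alpha> * sin \<beta>"
    "v \<bullet> k = - norm v * cos \<alpha>" "0 \<le> \<alpha>" "\<alpha> \<le> pi"
proof -
  have "norm k = 1" using fr by (simp add: right_handed_orthonormal_def)
  then have "\<bar>v \<bullet> k\<bar> \<le> norm v" using Cauchy_Schwarz_ineq2[of v k] by simp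
  then have le: "\<bar>- (v \<bullet> k) / norm v\<bar> \<le> 1" using nz by simp
  have cos: "cos \<alpha> = - (v \<bullet> k) / norm v"
    unfolding \<alpha> angle_of_attack_def using le by (intro cos_arccos_abs)
  show range: "0 \<le> \<alpha>" "\<alpha> \<le> pi"
    unfolding \<alpha> angle_of_attack_def using le
    by (intro arccos_lbound arccos_ubound; linarith)+
  show k: "v \<bullet> k = - norm v * cos \<alpha>" using cos nz by simp
  define z where "z = Complex (v \<bullet> i) (v \<bullet> j)"
  have "(cmod z)\<^sup>2 = (norm v * sin \<alpha>)\<^sup>2"
    using norm_frame_components[OF fr, of v]
    by (simp add: z_def cmod_power2 k power_mult_distrib sin_squared_eq algebra_simps)
  \<comment> \<open>The square root keeps its sign because the sine is nonnegative on the range of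
    \<open>arccos\<close>.\<close>
  then have cmod: "cmod z = norm v * sin \<alpha>"
    using range by (simp add: sin_ge_zero)
  have "z = rcis (cmod z) \<beta>"
    by (simp add: \<beta> sideslip_angle_def z_def[symmetric] rcis_cmod_Arg)
  then have "Re z = norm v * sin \<alpha> * cos \<beta>" "Im z = norm v * sin \<alpha> * sin \<beta>"
    using cmod by (metis Re_rcis, metis Im_rcis)
  then show "v \<bullet> i = norm v * sin \<alpha> * cos \<beta>" "v \<bullet> j = norm v * sin \<alpha> * sin \<beta>"
    by (simp_all add: z_def)
qed

lemma cross_lift_axis:
  assumes "right_handed_orthonormal i j k"
  shows "cross3 (lift_axis i j \<beta>) (x *\<^sub>R i + y *\<^sub>R j + z *\<^sub>R k) =
    z *\<^sub>R (cos \<beta> *\<^sub>R i + sin \<beta> *\<^sub>R j) - (x * cos \<beta> + y * sin \<beta>) *\<^sub>R k"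
proof -
  note c = right_handed_orthonormal_cross[OF assms]
  have c': "cross3 j i = - k" "cross3 i k = - j"
    using c by (metis cross_skew)+
  show ?thesis
    unfolding lift_axis_def
    by (simp only: cross_add_left cross_add_right cross_mult_left cross_mult_right c c' cross_refl)
      (simp add: algebra_simps)
qed

lemma cross_lift_axis_air_velocity:
  assumes fr: "right_handed_orthonormal i j k"
    and nz: "v \<noteq> 0"
    and \<alpha>: "\<alpha> = angle_of_attack k v"
    and \<beta>: "\<beta> = sideslip_angle i j v"
    and sin: "sin \<alpha> \<noteq> 0"
  shows "cross3 (lift_axis i j \<beta>) v = - cot \<alpha> *\<^sub>R v - (norm v / sin \<alpha>) *\<^sub>R k"
proof -
  note sph = air_velocity_spherical(1-3)[OF fr nz \<alpha> \<beta>]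
  define h where "h = cos \<beta> *\<^sub>R i + sin \<beta> *\<^sub>R j"
  have v: "v = (norm v * sin \<alpha> * cos \<beta>) *\<^sub>R i + (norm v * sin \<alpha> * sin \<beta>) *\<^sub>R j
      + (- norm v * cos \<alpha>) *\<^sub>R k"
    using right_handed_orthonormal_expansion[OF fr, of v] unfolding sph .
  have "cross3 (lift_axis i j \<beta>) v = (- norm v * cos \<alpha>) *\<^sub>R h
      - (norm v * sin \<alpha> * cos \<beta> * cos \<beta> + norm v * sin \<alpha> * sin \<beta> * sin \<beta>) *\<^sub>R k"
    by (subst v) (simp only: cross_lift_axis[OF fr] h_def)
  also have "norm v * sin \<alpha> * cos \<beta> * cos \<beta> + norm v * sin \<alpha> * sin \<beta> * sin \<beta> = norm v * sin \<alpha>"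
    using sin_cos_squared_add[of \<beta>] by algebra
  finally have cross: "cross3 (lift_axis i j \<beta>) v =
      (- norm v * cos \<alpha>) *\<^sub>R h - (norm v * sin \<alpha>) *\<^sub>R k" .
  have v_h: "v = (norm v * sin \<alpha>) *\<^sub>R h - (norm v * cos \<alpha>) *\<^sub>R k"
    by (subst v) (simp add: h_def scaleR_add_right)
  have "- cot \<alpha> *\<^sub>R v - (norm v / sin \<alpha>) *\<^sub>R k =
      - cot \<alpha> *\<^sub>R ((norm v * sin \<alpha>) *\<^sub>R h - (norm v * cos \<alpha>) *\<^sub>R k) - (norm v / sin \<alpha>) *\<^sub>R k"
    \<comment> \<open>Only the vector is rewritten; the \<open>v\<close> inside
      \<open>norm v\<close> has to stay.\<close>
    by (subst (1) v_h) (rule refl)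
  also have "\<dots> = (- norm v * (cot \<alpha> * sin \<alpha>)) *\<^sub>R h
      + (cot \<alpha> * (norm v * cos \<alpha>) - norm v / sin \<alpha>) *\<^sub>R k"
    by (simp add: algebra_simps)
  also have "cot \<alpha> * sin \<alpha> = cos \<alpha>"
    using sin by (simp add: cot_def)
  also have "cot \<alpha> * (norm v * cos \<alpha>) - norm v / sin \<alpha> = - (norm v * sin \<alpha>)"
  \<comment> \<open>After multiplication by \<open>sin \<alpha>\<close> this is the Pythagorean
    identity.\<close>
  proof -
    have "norm v * (cos \<alpha> * cos \<alpha>) + norm v * (sin \<alpha> * sin \<alpha>) = norm v"
      using sin_cos_squared_add[of \<alpha>] by algebra
    then show ?thesis
      using sin by (simp add: cot_def field_simps)
  qed
  finally show ?thesis using cross by simp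
qed

text \<open>Near the endpoint \<open>C\<^sub>L / sin\<close> is \<open>C\<^sub>L * cot\<close>
  divided by \<open>cos\<close>. The drag coefficient enters the relation at \<alpha> itself, so
  \<open>C\<^sub>L * cot\<close> tends to \<open>C\<^sub>D\<^sub>0 - C\<^sub>D \<alpha>\<close>;
  dividing by \<open>cos \<alpha>\<close>, which is 1 or -1, is the same as multiplying by
  it.\<close>

lemma lift_over_sin_axial:
  assumes "\<alpha> \<in> {0, pi}" and rel: "drag_lift_relation C\<^sub>D C\<^sub>L C\<^sub>D\<^sub>0 \<alpha>"
  shows "lift_over_sin C\<^sub>L \<alpha> = cos \<alpha> * (C\<^sub>D\<^sub>0 - C\<^sub>D \<alpha>)"
proof -
  let ?F = "at \<alpha> within {0<..<pi}"
  have not_inside: "\<not> (0 < \<alpha> \<and> \<alpha> < pi)" and cos: "cos \<alpha> \<noteq> 0" "1 / cos \<alpha> = cos \<alpha>"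
    using assms(1) by auto
  \<comment> \<open>Both endpoints are limit points of the open interval; this makes limits unique,
    so that \<open>Lim\<close> can be evaluated.\<close>
  have nontriv: "?F \<noteq> bot"
    using assms(1) by (auto simp: trivial_limit_within islimpt_greaterThanLessThan1
        islimpt_greaterThanLessThan2)
  have "((\<lambda>x. C\<^sub>D \<alpha> + C\<^sub>L x * cot x - C\<^sub>D \<alpha>) \<longlongrightarrow> C\<^sub>D\<^sub>0 - C\<^sub>D \<alpha>) ?F"
    using rel not_inside by (intro tendsto_diff tendsto_const) (simp add: drag_lift_relation_def)
  moreover have "((\<lambda>x. cos x) \<longlongrightarrow> cos \<alpha>) ?F"
    by (intro tendsto_intros)
  ultimately have "((\<lambda>x. (C\<^sub>D \<alpha> + C\<^sub>L x * cot x - C\<^sub>D \<alpha>) / cos x) \<longlongrightarrow> (C\<^sub>D\<^sub>0 - C\<^sub>D \<alpha>) / cos \<alpha>) ?F"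
    using cos by (intro tendsto_divide)
  \<comment> \<open>The cosine cancels only where it is nonzero, which holds close to the endpoint
    by continuity.\<close>
  moreover have "\<forall>\<^sub>F x in ?F. cos x \<noteq> 0"
    using \<open>((\<lambda>x. cos x) \<longlongrightarrow> cos \<alpha>) ?F\<close> cos(1) by (rule tendsto_imp_eventually_ne)
  then have "\<forall>\<^sub>F x in ?F. (C\<^sub>D \<alpha> + C\<^sub>L x * cot x - C\<^sub>D \<alpha>) / cos x = C\<^sub>L x / sin x"
    by eventually_elim (simp add: cot_def)
  ultimately have "((\<lambda>x. C\<^sub>L x / sin x) \<longlongrightarrow> (C\<^sub>D\<^sub>0 - C\<^sub>D \<alpha>) / cos \<alpha>) ?F"
    by (rule Lim_transform_eventually)
  then have "Lim ?F (\<lambda>x. C\<^sub>L x / sin x) = (C\<^sub>D\<^sub>0 - C\<^sub>D \<alpha>) / cos \<alpha>"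
    by (rule tendsto_Lim[OF nontriv])
  then show ?thesis
    using not_inside cos(2) by (simp add: lift_over_sin_def) (metis divide_inverse inverse_eq_divide mult.commute)
qed

text \<open>Both equations have the same right-hand side, whatever \<open>a\<close> is. The limit
  form of the relation is assumed only at an endpoint that \<alpha> actually attains.\<close>

theorem proposition1:
  fixes i j k G :: "real^3" and S :: "(real^3) set"
    and m \<rho> A k\<^sub>a T T\<^sub>p C\<^sub>D\<^sub>0 \<alpha> \<beta> :: real
    and a g v w v\<^sub>a F\<^sub>a F\<^sub>L F\<^sub>D F\<^sub>p :: "real^3"
    and C\<^sub>D C\<^sub>L :: "real \<Rightarrow> real"
  assumes frame: "right_handed_orthonormal i j k"
    and symmetric: "axisymmetric S G k"
    and air_velocity: "v\<^sub>a = v - w"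
    and k\<^sub>a: "k\<^sub>a = \<rho> * A / 2"
    and \<alpha>: "\<alpha> = angle_of_attack k v\<^sub>a"
    and \<beta>: "\<beta> = sideslip_angle i j v\<^sub>a"
    and lift_zero: "C\<^sub>L 0 = 0" "C\<^sub>L pi = 0"
    and lift: "F\<^sub>L = lift_force i j k\<^sub>a C\<^sub>L \<alpha> \<beta> v\<^sub>a"
    and drag: "F\<^sub>D = drag_force k\<^sub>a C\<^sub>D \<alpha> v\<^sub>a"
    and aero: "F\<^sub>a = F\<^sub>L + F\<^sub>D"
    and relation: "\<And>x. 0 < x \<Longrightarrow> x < pi \<Longrightarrow> drag_lift_relation C\<^sub>D C\<^sub>L C\<^sub>D\<^sub>0 x"
    and relation_axial: "\<alpha> \<in> {0, pi} \<Longrightarrow> drag_lift_relation C\<^sub>D C\<^sub>L C\<^sub>D\<^sub>0 \<alpha>"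
    and T\<^sub>p: "T\<^sub>p = T + k\<^sub>a * (norm v\<^sub>a)\<^sup>2 * lift_over_sin C\<^sub>L \<alpha>"
    and F\<^sub>p: "F\<^sub>p = - ((k\<^sub>a * C\<^sub>D\<^sub>0 * norm v\<^sub>a) *\<^sub>R v\<^sub>a)"
  shows "m *\<^sub>R a = m *\<^sub>R g + F\<^sub>a - T *\<^sub>R k \<longleftrightarrow> m *\<^sub>R a = m *\<^sub>R g + F\<^sub>p - T\<^sub>p *\<^sub>R k"
proof -
  have "F\<^sub>L + F\<^sub>D = F\<^sub>p - (k\<^sub>a * (norm v\<^sub>a)\<^sup>2 * lift_over_sin C\<^sub>L \<alpha>) *\<^sub>R k"
  proof (cases "v\<^sub>a = 0")
    \<comment> \<open>Here \<alpha> is merely the conventional value \<open>arccos 0\<close>, but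
      every aerodynamic term carries a factor \<open>norm v\<^sub>a\<close>.\<close>
    case True
    then show ?thesis
      by (simp add: lift drag F\<^sub>p lift_force_def drag_force_def)
  next
    case nz: False
    note sph = air_velocity_spherical[OF frame nz \<alpha> \<beta>]
    show ?thesis
    proof (cases "\<alpha> \<in> {0, pi}")
      case True
      have "sin \<alpha> = 0" "(cos \<alpha>)\<^sup>2 = 1" "C\<^sub>L \<alpha> = 0"
        using True lift_zero by auto
      have L: "lift_over_sin C\<^sub>L \<alpha> = cos \<alpha> * (C\<^sub>D\<^sub>0 - C\<^sub>D \<alpha>)"
        using lift_over_sin_axial[OF True relation_axial[OF True]] .
      have "v\<^sub>a = (v\<^sub>a \<bullet> i) *\<^sub>R i + (v\<^sub>a \<bullet> j) *\<^sub>R j + (v\<^sub>a \<bullet> k) *\<^sub>R k"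
        by (rule right_handed_orthonormal_expansion[OF frame])
      also have "\<dots> = (- norm v\<^sub>a * cos \<alpha>) *\<^sub>R k"
        unfolding sph(1-3) by (simp add: \<open>sin \<alpha> = 0\<close>)
      finally have v: "v\<^sub>a = (- norm v\<^sub>a * cos \<alpha>) *\<^sub>R k" .
      have "(norm v\<^sub>a * cos \<alpha>) *\<^sub>R k = - v\<^sub>a"
        by (subst (2) v) simp
      \<comment> \<open>The factor \<open>cos \<alpha>\<close> of the limit and one factor
        \<open>norm v\<^sub>a\<close> turn \<open>k\<close> into \<open>- v\<^sub>a\<close>; the
        result is exactly the difference between \<open>F\<^sub>p\<close> and the drag.\<close>
      then have "(k\<^sub>a * (norm v\<^sub>a)\<^sup>2 * lift_over_sin C\<^sub>L \<alpha>) *\<^sub>R k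
          = (k\<^sub>a * norm v\<^sub>a * (C\<^sub>D\<^sub>0 - C\<^sub>D \<alpha>)) *\<^sub>R (- v\<^sub>a)"
        by (metis (no_types, opaque_lifting) L power2_eq_square scaleR_scaleR mult.assoc mult.commute)
      then show ?thesis
        by (simp add: lift drag F\<^sub>p lift_force_def drag_force_def \<open>C\<^sub>L \<alpha> = 0\<close> algebra_simps)
    next
      case False
      then have inside: "0 < \<alpha>" "\<alpha> < pi" using sph(4,5) by auto
      then have "sin \<alpha> \<noteq> 0" using sin_gt_zero[of \<alpha>] by simp
      \<comment> \<open>Solved for the constant, the relation rewrites \<open>F\<^sub>p\<close> as
        the drag plus the part of the lift along \<open>v\<^sub>a\<close>.\<close>
      have C: "C\<^sub>D\<^sub>0 = C\<^sub>D \<alpha> + C\<^sub>L \<alpha> * cot \<alpha>"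
        using relation[OF inside] inside by (simp add: drag_lift_relation_def)
      show ?thesis
        using inside
        by (simp add: lift drag F\<^sub>p lift_force_def drag_force_def lift_over_sin_def C
            cross_lift_axis_air_velocity[OF frame nz \<alpha> \<beta> \<open>sin \<alpha> \<noteq> 0\<close>]
            power2_eq_square algebra_simps)
    qed
  qed
  then have "F\<^sub>a - T *\<^sub>R k = F\<^sub>p - T\<^sub>p *\<^sub>R k"
    by (simp add: aero T\<^sub>p algebra_simps)
  then show ?thesis
    by (simp add: add_diff_eq[symmetric])
qed

end
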